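(* For all real numbers $u,v \in (0,1)$, we have $$1 - uv \;\geq\; (1 - v)^{u^2}\, e^{uv(u-1)} \;\geq\; (1 - v)^u.$$
   Context: All powers are real powers of positive real numbers. *)

theory Defs
  imports Complex_Main
begin

end

theory Submission
  imports Defs
begin

text \<open>
  Let \<open>h x = - ln (1 - x) - x = (\<Sum>k\<ge>2. x ^ k / k)\<close>. After taking logarithms, the lower
  estimate is \<open>u * (1 - u) * h v \<ge> 0\<close>, that is, \<open>ln (1 - v) \<le> - v\<close>. The upper estimate is
  \<open>h (u * v) \<le> u\<^sup>2 * h v\<close>, which is clear from the series, where \<open>u ^ k \<le> u\<^sup>2\<close> for all
  \<open>k \<ge> 2\<close>; since \<open>h' x = x / (1 - x)\<close>, it also follows by differentiating in \<open>v\<close>, which is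
  how \<open>ln_one_minus_remainder_scale\<close> avoids the series.
\<close>

text \<open>
  As functions of \<open>v\<close> both sides vanish at \<open>0\<close>, and their derivatives are
  \<open>u\<^sup>2 * v / (1 - u * v)\<close> and \<open>u\<^sup>2 * v / (1 - v)\<close>, which differ only in the denominator.
\<close>
lemma ln_one_minus_remainder_scale:
  fixes u v :: real
  assumes u: "0 \<le> u" "u \<le> 1" and v: "0 \<le> v" "v < 1"
  shows "- ln (1 - u * v) - u * v \<le> u\<^sup>2 * (- ln (1 - v) - v)"
proof -
  let ?g = "\<lambda>t. u\<^sup>2 * (- ln (1 - t) - t) - (- ln (1 - u * t) - u * t)"
  have "?g 0 \<le> ?g v"
  proof (rule DERIV_nonneg_imp_nondecreasing[OF v(1)])
    fix t :: real
    assume t: "0 \<le> t" "t \<le> v"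
    have t1: "t < 1" using t v by simp
    have le: "u * t \<le> t" using u t by (simp add: mult_left_le_one_le)
    have ut1: "u * t < 1" using le t1 by simp
    let ?D = "u\<^sup>2 * (1 / (1 - t) - 1) - (u / (1 - u * t) - u)"
    have deriv: "(?g has_real_derivative ?D) (at t)"
      using t1 ut1 by (auto intro!: derivative_eq_intros)
    have "?D = u\<^sup>2 * t / (1 - t) - u\<^sup>2 * t / (1 - u * t)"
      using t1 ut1 by (simp add: field_simps power2_eq_square)
    moreover have "u\<^sup>2 * t / (1 - u * t) \<le> u\<^sup>2 * t / (1 - t)"
      using le t1 t by (intro divide_left_mono) auto
    ultimately have "0 \<le> ?D" by simp
    with deriv show "\<exists>D. (?g has_real_derivative D) (at t) \<and> 0 \<le> D" by blast
  qed
  then show ?thesis by simp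
qed

theorem mainTheorem1:
  fixes u v :: real
  assumes "u \<in> {0<..<1}" and "v \<in> {0<..<1}"
  shows "1 - u * v \<ge> (1 - v) powr (u\<^sup>2) * exp (u * v * (u - 1)) \<and>
    (1 - v) powr (u\<^sup>2) * exp (u * v * (u - 1)) \<ge> (1 - v) powr u"
proof -
  have u: "0 < u" "u < 1" and v: "0 < v" "v < 1" using assms by auto
  have "u * v < 1 * 1" using u v by (intro mult_strict_mono) auto
  then have uv: "0 < 1 - u * v" by simp
  have middle: "(1 - v) powr (u\<^sup>2) * exp (u * v * (u - 1)) = exp (u\<^sup>2 * ln (1 - v) + u * v * (u - 1))"
    using v by (simp add: powr_def exp_add)
  have "u\<^sup>2 * ln (1 - v) + u * v * (u - 1) \<le> ln (1 - u * v)"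
    using ln_one_minus_remainder_scale[of u v] u v
    by (simp add: algebra_simps power2_eq_square)
  then have upper: "exp (u\<^sup>2 * ln (1 - v) + u * v * (u - 1)) \<le> 1 - u * v"
    using uv by (simp add: ln_ge_iff)
  have "0 \<le> - ln (1 - v) - v"
    using ln_le_minus_one[of "1 - v"] v by simp
  then have "0 \<le> (u * (1 - u)) * (- ln (1 - v) - v)"
    using u by simp
  then have "u * ln (1 - v) \<le> u\<^sup>2 * ln (1 - v) + u * v * (u - 1)"
    by (simp add: algebra_simps power2_eq_square)
  then have lower: "(1 - v) powr u \<le> exp (u\<^sup>2 * ln (1 - v) + u * v * (u - 1))"
    using v by (simp add: powr_def)
  show ?thesis unfolding middle using upper lower by simp
qed

end
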